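(* Let $c\ge1$, let $G$ be a finite nilpotent group of class $t\ge2$, and let $G\cong F/R$ be a free presentation. Then (i)(a) if $c+1\le t$, then $|\gamma_t(G)|\,|M^{(c)}(G)|=|M^{(c)}(G/\gamma_t(G))|\,\left|[R\gamma_t(F),{}_cF]/[R,{}_cF]\right|$; (i)(b) if $c+1>t$, then $|\gamma_{c+1}(G)|\,|M^{(c)}(G)|=|M^{(c)}(G/\gamma_t(G))|\,\left|[R\gamma_t(F),{}_cF]/[R,{}_cF]\right|$; (ii) $\exp(M^{(c)}(G))$ divides $\exp(M^{(c)}(G/\gamma_t(G)))\exp\left([R\gamma_t(F),{}_cF]/[R,{}_cF]\right)$; (iii) $d(M^{(c)}(G))\le d(M^{(c)}(G/\gamma_t(G)))+d\left([R\gamma_t(F),{}_cF]/[R,{}_cF]\right)$.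
   Context: $\gamma_1(X)=X$, $\gamma_{i+1}(X)=[\gamma_i(X),X]$. For subgroups $U,V$, $[U,{}_0V]=U$, $[U,{}_{i+1}V]=[[U,{}_iV],V]$. The $c$-nilpotent multiplier of $G\cong F/R$ ($F$ free) is $M^{(c)}(G)=(R\cap\gamma_{c+1}(F))/[R,{}_cF]$, independent of the presentation. $d(X)$ is the minimal number of generators and $\exp(X)$ the exponent. *)

theory Defs
  imports "HOL-Algebra.Algebra"
begin

definition comm_subgroup :: "('a, 'b) monoid_scheme \<Rightarrow> 'a set \<Rightarrow> 'a set \<Rightarrow> 'a set" where
  "comm_subgroup G U V =
     generate G {inv\<^bsub>G\<^esub> u \<otimes>\<^bsub>G\<^esub> inv\<^bsub>G\<^esub> v \<otimes>\<^bsub>G\<^esub> u \<otimes>\<^bsub>G\<^esub> v | u v. u \<in> U \<and> v \<in> V}"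

fun comm_iter :: "('a, 'b) monoid_scheme \<Rightarrow> 'a set \<Rightarrow> 'a set \<Rightarrow> nat \<Rightarrow> 'a set" where
  "comm_iter G U V 0 = U"
| "comm_iter G U V (Suc i) = comm_subgroup G (comm_iter G U V i) V"

text \<open>Lower central series, indexed from 1: gamma G 1 = G, gamma G (i+1) = [gamma G i, G].
  (gamma G 0 is set to G as a harmless convention.)\<close>
fun gamma :: "('a, 'b) monoid_scheme \<Rightarrow> nat \<Rightarrow> 'a set" where
  "gamma G 0 = carrier G"
| "gamma G (Suc 0) = carrier G"
| "gamma G (Suc (Suc i)) = comm_subgroup G (gamma G (Suc i)) (carrier G)"

definition nilpotent_class :: "('a, 'b) monoid_scheme \<Rightarrow> nat \<Rightarrow> bool" where
  "nilpotent_class G t \<longleftrightarrow> gamma G (Suc t) = {\<one>\<^bsub>G\<^esub>} \<and> gamma G t \<noteq> {\<one>\<^bsub>G\<^esub>}"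

fun eval_word :: "('a, 'b) monoid_scheme \<Rightarrow> ('a \<times> bool) list \<Rightarrow> 'a" where
  "eval_word F [] = \<one>\<^bsub>F\<^esub>"
| "eval_word F ((x, b) # w) = (if b then x else inv\<^bsub>F\<^esub> x) \<otimes>\<^bsub>F\<^esub> eval_word F w"

definition reduced_word :: "('a \<times> bool) list \<Rightarrow> bool" where
  "reduced_word w \<longleftrightarrow> successively (\<lambda>p q. \<not> (fst p = fst q \<and> snd p \<noteq> snd q)) w"

definition free_group_on :: "('a, 'b) monoid_scheme \<Rightarrow> 'a set \<Rightarrow> bool" where
  "free_group_on F S \<longleftrightarrow> group F \<and> S \<subseteq> carrier F \<and> generate F S = carrier F \<and>
     (\<forall>w. w \<noteq> [] \<and> set (map fst w) \<subseteq> S \<and> reduced_word w \<longrightarrow> eval_word F w \<noteq> \<one>\<^bsub>F\<^esub>)"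

definition subquot :: "('a, 'b) monoid_scheme \<Rightarrow> 'a set \<Rightarrow> 'a set \<Rightarrow> 'a set monoid" where
  "subquot F A B = (F\<lparr>carrier := A\<rparr>) Mod B"

text \<open>c-nilpotent multiplier of F/R computed from the presentation:
  (R \<inter> gamma_(c+1)(F)) / [R, _c F].\<close>
definition c_multiplier :: "nat \<Rightarrow> ('a, 'b) monoid_scheme \<Rightarrow> 'a set \<Rightarrow> 'a set monoid" where
  "c_multiplier c F R = subquot F (R \<inter> gamma F (Suc c)) (comm_iter F R (carrier F) c)"

definition group_exponent :: "('a, 'b) monoid_scheme \<Rightarrow> nat" where
  "group_exponent G = (if \<exists>n::nat>0. \<forall>x\<in>carrier G. x [^]\<^bsub>G\<^esub> n = \<one>\<^bsub>G\<^esub>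
     then LEAST n::nat. n > 0 \<and> (\<forall>x\<in>carrier G. x [^]\<^bsub>G\<^esub> n = \<one>\<^bsub>G\<^esub>) else 0)"

definition min_gens :: "('a, 'b) monoid_scheme \<Rightarrow> nat" where
  "min_gens G = (LEAST n. \<exists>S. S \<subseteq> carrier G \<and> finite S \<and> card S = n \<and> generate G S = carrier G)"

end

theory Submission
  imports Defs
begin

text \<open>Let \<open>T = R \<gamma>\<^sub>t(F)\<close>, the preimage of \<open>\<gamma>\<^sub>t(G)\<close> in \<open>F\<close>. As \<open>G\<close> has class \<open>t\<close>,
  \<open>[T, F] \<subseteq> R\<close>, so \<open>[R,\<^sub>c F] \<subseteq> [T,\<^sub>c F] \<subseteq> R \<inter> \<gamma>\<^sub>c\<^sub>+\<^sub>1(F) \<subseteq> T \<inter> \<gamma>\<^sub>c\<^sub>+\<^sub>1(F)\<close>. Reading off the successive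
  quotients gives an exact sequence
  \<open>1 \<rightarrow> [T,\<^sub>c F]/[R,\<^sub>c F] \<rightarrow> M(G) \<rightarrow> M(G/\<gamma>\<^sub>t(G)) \<rightarrow> \<gamma>\<^sub>t(G) \<inter> \<gamma>\<^sub>c\<^sub>+\<^sub>1(G) \<rightarrow> 1\<close>,
  which yields the equation of orders and the bound on exponents. For the number of generators one
  also needs that the multipliers are abelian, because subgroups of an abelian group need no more
  generators than the group; this is \<open>[R, \<gamma>\<^sub>n(F)] \<subseteq> [R,\<^sub>n F]\<close>, an induction on \<open>n\<close> with the three
  subgroups lemma. For presentations of infinite rank no finiteness of the multipliers is needed:
  orders are compared by Lagrange's theorem in the convention \<open>card = 0\<close> for infinite sets, and
  if \<open>M(G)\<close> is not finitely generated, then one of the two groups on the right is not either, and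
  \<open>min_gens\<close> has the same junk value for all such groups.\<close>

section \<open>Exponents and numbers of generators along a homomorphism\<close>

text \<open>Division with remainder: if \<open>e\<close> is the least positive exponent, then
  \<open>n mod e\<close> is again an exponent and smaller than \<open>e\<close>, so it is 0. The
  default value 0 of \<open>group_exponent\<close> occurs only for \<open>n = 0\<close>, which
  everything divides.\<close>

lemma (in group) group_exponent_dvd:
  fixes n :: nat
  assumes n: "\<And>x. x \<in> carrier G \<Longrightarrow> x [^] n = \<one>"
  shows "group_exponent G dvd n"
proof (cases "n = 0")
  case False
  define P where "P e \<longleftrightarrow> e > 0 \<and> (\<forall>x\<in>carrier G. x [^] e = \<one>)" for e :: nat
  define e where "e = (LEAST e. P e)"
  have "P n" using n False by (simp add: P_def)
  then have e: "P e" unfolding e_def by (rule LeastI)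
  have exp: "group_exponent G = e"
    using \<open>P n\<close> unfolding group_exponent_def e_def P_def by (subst if_P) auto
  have "x [^] (n mod e) = \<one>" if x: "x \<in> carrier G" for x
  proof -
    have "x [^] n = x [^] (e * (n div e)) \<otimes> x [^] (n mod e)"
      using x by (simp add: nat_pow_mult)
    also have "x [^] (e * (n div e)) = \<one>"
      using x e by (simp add: P_def flip: nat_pow_pow)
    finally show ?thesis using n[OF x] x by simp
  qed
  moreover have "n mod e < e" using e by (simp add: P_def)
  ultimately have "n mod e = 0"
    using not_less_Least[of "n mod e" P] unfolding e_def[symmetric] by (auto simp: P_def)
  then show ?thesis by (simp add: exp mod_eq_0_iff_dvd)
qed simp

lemma pow_group_exponent:
  assumes "x \<in> carrier G" "group_exponent G \<noteq> 0"
  shows "x [^]\<^bsub>G\<^esub> group_exponent G = \<one>\<^bsub>G\<^esub>"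
proof -
  define P where "P e \<longleftrightarrow> e > 0 \<and> (\<forall>x\<in>carrier G. x [^]\<^bsub>G\<^esub> e = \<one>\<^bsub>G\<^esub>)" for e :: nat
  have ex: "\<exists>e. P e" using assms(2) unfolding P_def group_exponent_def by presburger
  then have "group_exponent G = (LEAST e. P e)"
    unfolding P_def group_exponent_def by (subst if_P) auto
  then have "P (group_exponent G)" using LeastI_ex[OF ex] by simp
  then show ?thesis using assms(1) by (simp add: P_def)
qed

text \<open>Raising to the power \<open>group_exponent H\<close> moves every element into the
  kernel, and the exponent of the kernel finishes. If one factor is 0, meaning that there is no
  finite exponent, the product is 0 and divisibility is trivial.\<close>

lemma (in group_hom) group_exponent_dvd_mult:
  "group_exponent G dvd group_exponent H * group_exponent (G\<lparr>carrier := kernel G H h\<rparr>)"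
proof (cases "group_exponent H = 0 \<or> group_exponent (G\<lparr>carrier := kernel G H h\<rparr>) = 0")
  case False
  let ?K = "G\<lparr>carrier := kernel G H h\<rparr>"
  have "x [^] (group_exponent H * group_exponent ?K) = \<one>" if x: "x \<in> carrier G" for x
  proof -
    have "h (x [^] group_exponent H) = \<one>\<^bsub>H\<^esub>"
      using x False pow_group_exponent[of "h x" H] by (simp add: hom_nat_pow)
    then have "x [^] group_exponent H \<in> carrier ?K"
      using x by (simp add: kernel_def)
    then have "(x [^] group_exponent H) [^]\<^bsub>?K\<^esub> group_exponent ?K = \<one>"
      using False pow_group_exponent[of _ ?K] by simp
    then show ?thesis using x by (simp add: G.nat_pow_pow flip: G.nat_pow_consistent)
  qed
  then show ?thesis by (rule G.group_exponent_dvd)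
qed auto

section \<open>Numbers of generators\<close>

definition finitely_generated :: "('a, 'b) monoid_scheme \<Rightarrow> bool" where
  "finitely_generated G \<longleftrightarrow> (\<exists>S. S \<subseteq> carrier G \<and> finite S \<and> generate G S = carrier G)"

lemma min_gens_le:
  assumes "S \<subseteq> carrier G" "finite S" "generate G S = carrier G"
  shows "min_gens G \<le> card S"
  unfolding min_gens_def using assms by (intro Least_le) blast

lemma finitely_generatedE:
  assumes "finitely_generated G"
  obtains S where "S \<subseteq> carrier G" "finite S" "card S = min_gens G" "generate G S = carrier G"
proof -
  have "\<exists>n S. S \<subseteq> carrier G \<and> finite S \<and> card S = n \<and> generate G S = carrier G"
    using assms unfolding finitely_generated_def by blast
  from LeastI_ex[OF this] show thesis using that unfolding min_gens_def by blast
qed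

text \<open>The value is the junk value of \<open>LEAST\<close> on an empty predicate, but it is always the same one.\<close>

lemma min_gens_not_finitely_generated:
  assumes "\<not> finitely_generated G"
  shows "min_gens G = (LEAST n. False)"
  using assms unfolding min_gens_def finitely_generated_def by (intro arg_cong[of _ _ Least]) blast

text \<open>Subgroups of the integers are cyclic: \<open>m\<close> is the least positive element, or
  0 if there is none.\<close>

lemma int_closed_diff_generator:
  fixes I :: "int set"
  assumes "0 \<in> I" and diff: "\<And>x y. x \<in> I \<Longrightarrow> y \<in> I \<Longrightarrow> x - y \<in> I"
  obtains m where "m \<in> I" "\<And>k. k \<in> I \<Longrightarrow> m dvd k"
proof (cases "\<exists>k\<in>I. k \<noteq> 0")
  case False
  with assms that[of 0] show thesis by auto
next
  case True
  then obtain k where k: "k \<in> I" "k \<noteq> 0" by blast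
  have neg: "- x \<in> I" if "x \<in> I" for x using diff[OF assms(1) that] by simp
  have add: "x + y \<in> I" if "x \<in> I" "y \<in> I" for x y using diff[OF that(1) neg[OF that(2)]] by simp
  define P where "P n \<longleftrightarrow> n > 0 \<and> int n \<in> I" for n
  have "P (nat \<bar>k\<bar>)" using k neg[of k] by (auto simp: P_def abs_if)
  define m where "m = (LEAST n. P n)"
  have m: "P m" unfolding m_def by (rule LeastI) fact
  have mult: "int n * int m \<in> I" for n
    by (induction n) (use m add assms(1) in \<open>auto simp: P_def algebra_simps\<close>)
  have mult': "q * int m \<in> I" for q
    using mult[of "nat q"] neg[OF mult[of "nat (- q)"]] by (cases "q \<ge> 0") auto
  have "int m dvd x" if "x \<in> I" for x
  proof -
    have "x mod int m \<in> I"
      using diff[OF that mult'[of "x div int m"]] by (simp add: minus_div_mult_eq_mod)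
    moreover have "x mod int m < int m" "x mod int m \<ge> 0" using m by (auto simp: P_def)
    ultimately have "\<not> 0 < nat (x mod int m)"
      using not_less_Least[of "nat (x mod int m)" P] unfolding m_def[symmetric]
      by (auto simp: P_def nat_less_iff)
    then show ?thesis using \<open>x mod int m \<ge> 0\<close> by auto
  qed
  with that[of "int m"] m show thesis by (auto simp: P_def)
qed

text \<open>By commutativity the products of a power of \<open>a\<close> with an element of
  \<open>generate G S\<close> already form a subgroup.\<close>

lemma (in comm_group) generate_insert_comm:
  assumes "a \<in> carrier G" "S \<subseteq> carrier G" "x \<in> generate G (insert a S)"
  obtains k :: int and l where "l \<in> generate G S" "x = a [^] k \<otimes> l"
proof -
  define D where "D = {a [^] k \<otimes> l | (k::int) l. l \<in> generate G S}"
  have S: "subgroup (generate G S) G" by (rule generate_is_subgroup[OF assms(2)])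
  note [simp] = subgroup.mem_carrier[OF S] assms(1)
  have "subgroup D G"
  proof (rule subgroupI)
    show "D \<subseteq> carrier G" by (auto simp: D_def)
    show "D \<noteq> {}" using subgroup.one_closed[OF S] by (auto simp: D_def)
  next
    fix x assume "x \<in> D"
    then obtain k l where x: "x = a [^] (k::int) \<otimes> l" "l \<in> generate G S" by (auto simp: D_def)
    then have "inv x = a [^] (-k) \<otimes> inv l" by (simp add: inv_mult int_pow_neg)
    then show "inv x \<in> D" using subgroup.m_inv_closed[OF S x(2)] by (auto simp: D_def)
  next
    fix x y assume "x \<in> D" "y \<in> D"
    then obtain k l k' l' where x: "x = a [^] (k::int) \<otimes> l" "l \<in> generate G S"
      "y = a [^] (k'::int) \<otimes> l'" "l' \<in> generate G S" by (auto simp: D_def)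
    then have "x \<otimes> y = a [^] (k + k') \<otimes> (l \<otimes> l')"
      by (simp add: int_pow_mult m_ac)
    then show "x \<otimes> y \<in> D" using subgroup.m_closed[OF S x(2,4)] by (auto simp: D_def)
  qed
  moreover have "insert a S \<subseteq> D"
  proof -
    have "a = a [^] (1::int) \<otimes> \<one>" by simp
    moreover have "s = a [^] (0::int) \<otimes> s" if "s \<in> S" for s using that assms by auto
    ultimately show ?thesis
      using generate.incl[of _ S G] subgroup.one_closed[OF S] unfolding D_def by blast
  qed
  ultimately have "x \<in> D" using generate_subgroup_incl assms(3) by blast
  then show thesis using that by (auto simp: D_def)
qed

text \<open>Induction on \<open>S\<close>. After adding \<open>a\<close>, the part of
  \<open>H\<close> inside \<open>generate G S\<close> is covered by the induction hypothesis, and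
  the exponents of \<open>a\<close> that occur in \<open>H\<close> form a cyclic group of integers,
  so one further generator suffices.\<close>

lemma (in comm_group) subgroup_generators:
  assumes "finite S" "S \<subseteq> carrier G" "subgroup H G" "H \<subseteq> generate G S"
  obtains T where "finite T" "T \<subseteq> H" "card T \<le> card S" "generate G T = H"
proof -
  have "\<exists>T. finite T \<and> T \<subseteq> H \<and> card T \<le> card S \<and> generate G T = H"
    using assms
  proof (induction S arbitrary: H rule: finite_induct)
    case empty
    then have "H = {\<one>}" using subgroup.one_closed by (fastforce simp: generate_empty)
    then show ?case by (intro exI[of _ "{}"]) (simp add: generate_empty)
  next
    case (insert a S)
    then have a: "a \<in> carrier G" and S: "S \<subseteq> carrier G" by auto
    define L where "L = generate G S"
    have L: "subgroup L G" unfolding L_def by (rule generate_is_subgroup[OF S])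
    note H = insert.prems(2)
    have "subgroup (H \<inter> L) G" by (rule subgroups_Inter_pair[OF H L])
    with insert.IH[of "H \<inter> L"] S obtain T
      where T: "finite T" "T \<subseteq> H \<inter> L" "card T \<le> card S" "generate G T = H \<inter> L"
      by (auto simp: L_def)
    \<comment> \<open>The exponents of \<open>a\<close> in elements of \<open>H\<close>, read modulo
      \<open>L\<close>; \<open>h\<close> below is an element of \<open>H\<close> realising their
      generator \<open>m\<close>.\<close>
    define I where "I = {k::int. \<exists>l\<in>L. a [^] k \<otimes> l \<in> H}"
    note mem [simp] = a subgroup.mem_carrier[OF H] subgroup.mem_carrier[OF L]
    have "0 \<in> I"
      using subgroup.one_closed[OF H] subgroup.one_closed[OF L] by (auto simp: I_def intro!: bexI[of _ \<one>])
    moreover have "k - k' \<in> I" if "k \<in> I" "k' \<in> I" for k k'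
    proof -
      from that obtain l l' where l: "l \<in> L" "l' \<in> L" "a [^] k \<otimes> l \<in> H" "a [^] k' \<otimes> l' \<in> H"
        by (auto simp: I_def)
      have "(a [^] k \<otimes> l) \<otimes> inv (a [^] k' \<otimes> l') = a [^] (k - k') \<otimes> (l \<otimes> inv l')"
        using l by (simp add: int_pow_diff inv_mult m_ac)
      moreover have "(a [^] k \<otimes> l) \<otimes> inv (a [^] k' \<otimes> l') \<in> H"
        using l H by (simp add: subgroup.m_closed subgroup.m_inv_closed)
      moreover have "l \<otimes> inv l' \<in> L"
        using l L by (simp add: subgroup.m_closed subgroup.m_inv_closed)
      ultimately show ?thesis by (auto simp: I_def)
    qed
    ultimately obtain m where m: "m \<in> I" "\<And>k. k \<in> I \<Longrightarrow> m dvd k"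
      using int_closed_diff_generator[of I] by blast
    from m(1) obtain l where l: "l \<in> L" "a [^] m \<otimes> l \<in> H" by (auto simp: I_def)
    define h where "h = a [^] m \<otimes> l"
    have h: "h \<in> H" using l by (simp add: h_def)
    have sub: "subgroup (generate G (insert h T)) G"
      by (rule generate_is_subgroup) (use h T in auto)
    have "H \<subseteq> generate G (insert h T)"
    proof
      fix x assume x: "x \<in> H"
      with insert.prems have "x \<in> generate G (insert a S)" by blast
      then obtain k l' where kl: "l' \<in> L" "x = a [^] (k::int) \<otimes> l'"
        using generate_insert_comm[OF a S] unfolding L_def by blast
      with x have "k \<in> I" by (auto simp: I_def)
      with m(2) obtain q where q: "k = m * q" by (auto elim: dvdE)
      \<comment> \<open>Dividing by \<open>h [^] q\<close> cancels the power of \<open>a\<close>,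
        which leaves an element of \<open>H \<inter> L = generate G T\<close>.\<close>
      define y where "y = x \<otimes> inv (h [^] q)"
      have hq: "h [^] q = a [^] k \<otimes> l [^] q"
        using l by (simp add: h_def q int_pow_mult_distrib m_comm int_pow_pow)
      have "y = l' \<otimes> inv (l [^] q)"
        using l(1) kl by (simp add: y_def hq inv_mult m_ac)
          (simp add: m_assoc[symmetric])
      moreover have "l' \<otimes> inv (l [^] q) \<in> L"
        by (intro subgroup.m_closed[OF L] subgroup.m_inv_closed[OF L] kl subgroup_int_pow_closed[OF L] l)
      moreover have "y \<in> H" unfolding y_def
        by (intro subgroup.m_closed[OF H] subgroup.m_inv_closed[OF H] x subgroup_int_pow_closed[OF H] h)
      ultimately have "y \<in> generate G T" using T by simp
      then have "y \<in> generate G (insert h T)" using mono_generate[of T "insert h T"] by blast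
      moreover have "h [^] q \<in> generate G (insert h T)"
        by (intro subgroup_int_pow_closed[OF sub] generate.incl) simp
      ultimately have "y \<otimes> h [^] q \<in> generate G (insert h T)"
        by (rule subgroup.m_closed[OF sub])
      moreover have "y \<otimes> h [^] q = x" using x h by (simp add: y_def m_assoc)
      ultimately show "x \<in> generate G (insert h T)" by simp
    qed
    moreover have "generate G (insert h T) \<subseteq> H"
      using h T by (intro generate_subgroup_incl[OF _ H]) auto
    moreover have "card (insert h T) \<le> card (insert a S)"
      using insert.hyps T by (simp add: card_insert_if)
    ultimately show ?case using h T by (intro exI[of _ "insert h T"]) auto
  qed
  then show thesis using that by blast
qed

text \<open>Every \<open>x\<close> has the same image as some \<open>s\<close> generated by
  \<open>S\<close>, and \<open>inv s \<otimes> x\<close> lies in the kernel, which \<open>T\<close>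
  generates.\<close>

lemma (in group_hom) generate_lift:
  assumes S: "S \<subseteq> carrier G" "generate H (h ` S) = h ` carrier G"
    and T: "T \<subseteq> kernel G H h" "generate G T = kernel G H h"
  shows "generate G (S \<union> T) = carrier G"
proof -
  have ST: "S \<union> T \<subseteq> carrier G" using S T by (auto simp: kernel_def)
  note sub = G.generate_is_subgroup[OF ST]
  have "x \<in> generate G (S \<union> T)" if x: "x \<in> carrier G" for x
  proof -
    have "h x \<in> h ` generate G S" using x S generate_img[of S] by auto
    then obtain s where s: "s \<in> generate G S" "h x = h s" by blast
    then have s': "s \<in> carrier G" using G.generate_in_carrier S by blast
    have "inv s \<otimes> x \<in> generate G T" using s s' x T by (simp add: kernel_def)
    then have "inv s \<otimes> x \<in> generate G (S \<union> T)" using G.mono_generate[of T "S \<union> T"] by blast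
    moreover have "s \<in> generate G (S \<union> T)" using s G.mono_generate[of S "S \<union> T"] by blast
    ultimately have "s \<otimes> (inv s \<otimes> x) \<in> generate G (S \<union> T)"
      using subgroup.m_closed[OF sub] by blast
    moreover have "s \<otimes> (inv s \<otimes> x) = x" using s' x by (simp add: G.m_assoc[symmetric])
    ultimately show ?thesis by simp
  qed
  then show ?thesis using subgroup.subset[OF sub] by blast
qed

text \<open>Lift generators of the image and add generators of the kernel. Since \<open>h\<close>
  may fail to be surjective, commutativity of \<open>H\<close> is what bounds the generators of the
  image by those of \<open>H\<close>. Finite index excludes the case that \<open>G\<close> is
  finitely generated and \<open>H\<close> is not, in which \<open>min_gens H\<close> would be a junk
  value.\<close>

lemma (in group_hom) min_gens_le_add:
  assumes comm: "comm_group G" "comm_group H" and fin: "finite (rcosets\<^bsub>H\<^esub> (h ` carrier G))"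
  shows "min_gens G \<le> min_gens H + min_gens (G\<lparr>carrier := kernel G H h\<rparr>)"
proof -
  let ?K = "G\<lparr>carrier := kernel G H h\<rparr>"
  interpret GC: comm_group G by fact
  interpret HC: comm_group H by fact
  have img: "subgroup (h ` carrier G) H" by (rule img_is_subgroup)
  have lift: "\<exists>U. U \<subseteq> carrier G \<and> finite U \<and> generate G U = carrier G
      \<and> card U \<le> min_gens H + min_gens ?K"
    if fg: "finitely_generated H" "finitely_generated ?K"
  proof -
    from fg(1) obtain S where S: "S \<subseteq> carrier H" "finite S" "card S = min_gens H"
      "generate H S = carrier H" by (rule finitely_generatedE)
    with img obtain S' where S': "finite S'" "S' \<subseteq> h ` carrier G" "card S' \<le> card S"
      "generate H S' = h ` carrier G"
      by (elim HC.subgroup_generators[of S "h ` carrier G"]) auto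
    \<comment> \<open>\<open>V\<close> picks one preimage for each element of \<open>S'\<close>, so
      that \<open>card V = card S'\<close>.\<close>
    obtain V where V: "V \<subseteq> carrier G" "inj_on h V" "S' = h ` V"
      using S'(2) by (auto simp: subset_image_inj)
    from fg(2) obtain T where T: "T \<subseteq> carrier ?K" "finite T" "card T = min_gens ?K"
      "generate ?K T = carrier ?K" by (rule finitely_generatedE)
    have "generate G T = kernel G H h"
      using T G.generate_consistent[of T, OF _ subgroup_kernel] by simp
    then have "generate G (V \<union> T) = carrier G"
      using V S' T by (intro generate_lift) auto
    moreover have "card (V \<union> T) \<le> min_gens H + min_gens ?K"
      using card_Un_le[of V T] V S S' T by (simp add: card_image)
    moreover have "finite (V \<union> T)" "V \<union> T \<subseteq> carrier G"
      using V S' T by (auto simp: finite_image_iff kernel_def)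
    ultimately show ?thesis by blast
  qed
  show ?thesis
  proof (cases "finitely_generated G")
    case False
    \<comment> \<open>One summand on the right is now the same junk value as the left-hand
      side.\<close>
    then have "\<not> finitely_generated H \<or> \<not> finitely_generated ?K"
      using lift unfolding finitely_generated_def[of G] by blast
    then show ?thesis using False by (auto simp: min_gens_not_finitely_generated)
  next
    case True
    then obtain S where S: "S \<subseteq> carrier G" "finite S" "generate G S = carrier G"
      by (auto simp: finitely_generated_def)
    obtain T where T: "finite T" "T \<subseteq> kernel G H h" "generate G T = kernel G H h"
      using GC.subgroup_generators[OF S(2,1) subgroup_kernel] S subgroup.subset[OF subgroup_kernel]
      by metis
    then have K: "finitely_generated ?K"
      using G.generate_consistent[of T, OF _ subgroup_kernel]
      by (auto simp: finitely_generated_def)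
    define rep where "rep Q = (SOME x. x \<in> Q)" for Q :: "'c set"
    define C where "C = rep ` (rcosets\<^bsub>H\<^esub> (h ` carrier G))"
    have rep: "rep Q \<in> Q" if "Q \<in> rcosets\<^bsub>H\<^esub> (h ` carrier G)" for Q
      using subgroup.rcosets_non_empty[OF img that] unfolding rep_def by (simp add: some_in_eq)
    have C: "C \<subseteq> carrier H"
      using rep subgroup.rcosets_carrier[OF img H.group_axioms] unfolding C_def by blast
    have SC: "h ` S \<union> C \<subseteq> carrier H" using S C by auto
    note sub = H.generate_is_subgroup[OF SC]
    have "y \<in> generate H (h ` S \<union> C)" if y: "y \<in> carrier H" for y
    proof -
      define Q where "Q = h ` carrier G #>\<^bsub>H\<^esub> y"
      have Q: "Q \<in> rcosets\<^bsub>H\<^esub> (h ` carrier G)"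
        using y by (auto simp: Q_def RCOSETS_def)
      then have "rep Q \<in> Q" by (rule rep)
      then obtain g where g: "g \<in> carrier G" "rep Q = h g \<otimes>\<^bsub>H\<^esub> y"
        by (auto simp: Q_def r_coset_def)
      have "inv g \<in> generate G S" using S g by simp
      then have "h (inv g) \<in> generate H (h ` S)" using generate_img[OF S(1)] by blast
      then have "h (inv g) \<in> generate H (h ` S \<union> C)"
        using H.mono_generate[of "h ` S" "h ` S \<union> C"] by blast
      moreover have "rep Q \<in> generate H (h ` S \<union> C)"
        using Q by (intro generate.incl) (simp add: C_def)
      ultimately have "h (inv g) \<otimes>\<^bsub>H\<^esub> rep Q \<in> generate H (h ` S \<union> C)"
        using subgroup.m_closed[OF sub] by blast
      then show ?thesis using g y by (simp add: H.m_assoc[symmetric])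
    qed
    then have "generate H (h ` S \<union> C) = carrier H" using subgroup.subset[OF sub] by blast
    moreover have "finite (h ` S \<union> C)" using S fin by (simp add: C_def)
    ultimately have "finitely_generated H" using SC unfolding finitely_generated_def by blast
    then show ?thesis using lift[OF _ K] min_gens_le[of _ G] order_trans by blast
  qed
qed

text \<open>First isomorphism theorem and Lagrange. Infinite groups are included: with
  \<open>card = 0\<close> for infinite sets, both sides vanish together.\<close>

lemma (in group_hom) order_eq_kernel_image:
  "order G = card (kernel G H h) * card (h ` carrier G)"
proof -
  have "bij_betw (\<lambda>Q. the_elem (h ` Q)) (rcosets (kernel G H h)) (h ` carrier G)"
  proof -
    \<comment> \<open>Shrinking the codomain to the image makes \<open>h\<close> surjective, as the
      isomorphism theorem demands.\<close>
    interpret I: group_hom G "H\<lparr>carrier := h ` carrier G\<rparr>" h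
      using H.subgroup_imp_group[OF img_is_subgroup]
      by (auto simp: group_hom_def group_hom_axioms_def hom_def)
    have "kernel G (H\<lparr>carrier := h ` carrier G\<rparr>) h = kernel G H h" by (simp add: kernel_def)
    then show ?thesis
      using I.FactGroup_iso_set by (simp add: iso_def FactGroup_def)
  qed
  then have "card (rcosets (kernel G H h)) = card (h ` carrier G)" by (rule bij_betw_same_card)
  then show ?thesis using G.lagrange[OF subgroup_kernel] by (simp add: mult.commute)
qed

section \<open>Commutator subgroups\<close>

definition commutator :: "('a, 'b) monoid_scheme \<Rightarrow> 'a \<Rightarrow> 'a \<Rightarrow> 'a" where
  "commutator G u v = inv\<^bsub>G\<^esub> u \<otimes>\<^bsub>G\<^esub> inv\<^bsub>G\<^esub> v \<otimes>\<^bsub>G\<^esub> u \<otimes>\<^bsub>G\<^esub> v"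

lemma comm_subgroup_eq:
  "comm_subgroup G U V = generate G {commutator G u v | u v. u \<in> U \<and> v \<in> V}"
  by (simp add: comm_subgroup_def commutator_def)

context group
begin

lemma inv_l_cancel: "x \<in> carrier G \<Longrightarrow> y \<in> carrier G \<Longrightarrow> inv x \<otimes> (x \<otimes> y) = y"
  by (simp add: m_assoc[symmetric])

lemma inv_r_cancel: "x \<in> carrier G \<Longrightarrow> y \<in> carrier G \<Longrightarrow> x \<otimes> (inv x \<otimes> y) = y"
  by (simp add: m_assoc[symmetric])

text \<open>These rules bring words in group elements into right-associated, freely reduced form, so
  that \<open>simp\<close> decides commutator identities.\<close>

lemmas word_simps = commutator_def m_assoc inv_mult_group inv_l_cancel inv_r_cancel

lemma commutator_closed [simp, intro]:
  "u \<in> carrier G \<Longrightarrow> v \<in> carrier G \<Longrightarrow> commutator G u v \<in> carrier G"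
  by (simp add: commutator_def)

lemma inv_commutator:
  "u \<in> carrier G \<Longrightarrow> v \<in> carrier G \<Longrightarrow> inv (commutator G u v) = commutator G v u"
  by (simp add: word_simps)

lemma comm_subgroup_is_subgroup:
  "U \<subseteq> carrier G \<Longrightarrow> V \<subseteq> carrier G \<Longrightarrow> subgroup (comm_subgroup G U V) G"
  unfolding comm_subgroup_eq by (intro generate_is_subgroup) blast

lemma commutator_in_comm_subgroup:
  "u \<in> U \<Longrightarrow> v \<in> V \<Longrightarrow> commutator G u v \<in> comm_subgroup G U V"
  unfolding comm_subgroup_eq by (intro generate.incl) blast

lemma comm_subgroup_least:
  assumes "subgroup N G" "\<And>u v. u \<in> U \<Longrightarrow> v \<in> V \<Longrightarrow> commutator G u v \<in> N"
  shows "comm_subgroup G U V \<subseteq> N"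
  unfolding comm_subgroup_eq using assms by (intro generate_subgroup_incl) auto

lemma comm_subgroup_mono:
  "U \<subseteq> U' \<Longrightarrow> V \<subseteq> V' \<Longrightarrow> comm_subgroup G U V \<subseteq> comm_subgroup G U' V'"
  unfolding comm_subgroup_eq by (intro mono_generate) blast

lemma normal_subset: "N \<lhd> G \<Longrightarrow> N \<subseteq> carrier G"
  by (simp add: normal_imp_subgroup subgroup.subset)

lemma normal_carrier: "carrier G \<lhd> G"
  by (intro normal_invI subgroup_self) simp

lemma comm_subgroup_normal:
  assumes "U \<lhd> G" "V \<lhd> G"
  shows "comm_subgroup G U V \<lhd> G"
  unfolding comm_subgroup_eq
proof (rule normal_generateI)
  note [simp] = subsetD[OF normal_subset[OF assms(1)]] subsetD[OF normal_subset[OF assms(2)]]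
  show "{commutator G u v | u v. u \<in> U \<and> v \<in> V} \<subseteq> carrier G" by auto
  fix c g assume "c \<in> {commutator G u v | u v. u \<in> U \<and> v \<in> V}" and g [simp]: "g \<in> carrier G"
  then obtain u v where uv: "c = commutator G u v" "u \<in> U" "v \<in> V" by blast
  then have "g \<otimes> c \<otimes> inv g = commutator G (g \<otimes> u \<otimes> inv g) (g \<otimes> v \<otimes> inv g)"
    by (simp add: word_simps)
  moreover have "g \<otimes> u \<otimes> inv g \<in> U" "g \<otimes> v \<otimes> inv g \<in> V"
    using uv assms by (simp_all add: normal.inv_op_closed2)
  ultimately show "g \<otimes> c \<otimes> inv g \<in> {commutator G u v | u v. u \<in> U \<and> v \<in> V}" by blast
qed

lemma comm_subgroup_subset_left:
  assumes "U \<lhd> G" "V \<subseteq> carrier G"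
  shows "comm_subgroup G U V \<subseteq> U"
proof (rule comm_subgroup_least)
  show U: "subgroup U G" using assms by (simp add: normal_imp_subgroup)
  fix u v assume uv: "u \<in> U" "v \<in> V"
  then have [simp]: "u \<in> carrier G" "v \<in> carrier G" using assms normal_subset by auto
  have "commutator G u v = inv u \<otimes> (inv v \<otimes> u \<otimes> v)" by (simp add: word_simps)
  also have "\<dots> \<in> U"
    using uv assms
    by (intro subgroup.m_closed[OF U] subgroup.m_inv_closed[OF U] normal.inv_op_closed1) auto
  finally show "commutator G u v \<in> U" .
qed

lemma comm_subgroup_commute:
  assumes "U \<subseteq> carrier G" "V \<subseteq> carrier G"
  shows "comm_subgroup G U V = comm_subgroup G V U"
proof -
  have "comm_subgroup G U V \<subseteq> comm_subgroup G V U"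
    if UV: "U \<subseteq> carrier G" "V \<subseteq> carrier G" for U V
  proof (rule comm_subgroup_least)
    show sub: "subgroup (comm_subgroup G V U) G" using UV by (intro comm_subgroup_is_subgroup)
    fix u v assume uv: "u \<in> U" "v \<in> V"
    then have "commutator G u v = inv (commutator G v u)" using UV by (subst inv_commutator) auto
    then show "commutator G u v \<in> comm_subgroup G V U"
      using subgroup.m_inv_closed[OF sub commutator_in_comm_subgroup] uv by simp
  qed
  then show ?thesis using assms by blast
qed

text \<open>These are the elements that commute with \<open>Y\<close> modulo \<open>N\<close>.
  Closure rests on writing \<open>[a\<^sup>-\<^sup>1, y]\<close> and \<open>[a b, y]\<close> as
  products of conjugates of commutators in \<open>N\<close> or their inverses. It extends a
  condition checked on generators to the subgroup that they generate.\<close>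

lemma subgroup_centralizer_mod:
  assumes "N \<lhd> G" "Y \<subseteq> carrier G"
  shows "subgroup {w \<in> carrier G. \<forall>y\<in>Y. commutator G w y \<in> N} G"
proof (rule subgroupI)
  have N: "subgroup N G" using assms by (simp add: normal_imp_subgroup)
  have Y: "y \<in> carrier G" if "y \<in> Y" for y using that assms by blast
  show "{w \<in> carrier G. \<forall>y\<in>Y. commutator G w y \<in> N} \<noteq> {}"
    using subgroup.one_closed[OF N] Y by (auto intro!: exI[of _ \<one>] simp: word_simps)
  fix a assume a: "a \<in> {w \<in> carrier G. \<forall>y\<in>Y. commutator G w y \<in> N}"
  have "commutator G (inv a) y \<in> N" if y: "y \<in> Y" for y
  proof -
    have "commutator G (inv a) y = a \<otimes> inv (commutator G a y) \<otimes> inv a"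
      using a Y[OF y] by (simp add: word_simps)
    then show ?thesis
      using a y by (simp add: assms normal.inv_op_closed2 subgroup.m_inv_closed[OF N])
  qed
  then show "inv a \<in> {w \<in> carrier G. \<forall>y\<in>Y. commutator G w y \<in> N}" using a by simp
  fix b assume b: "b \<in> {w \<in> carrier G. \<forall>y\<in>Y. commutator G w y \<in> N}"
  have "commutator G (a \<otimes> b) y \<in> N" if y: "y \<in> Y" for y
  proof -
    have "commutator G (a \<otimes> b) y = (inv b \<otimes> commutator G a y \<otimes> b) \<otimes> commutator G b y"
      using a b Y[OF y] by (simp add: word_simps)
    then show ?thesis
      using a b y by (simp add: assms normal.inv_op_closed1 subgroup.m_closed[OF N])
  qed
  then show "a \<otimes> b \<in> {w \<in> carrier G. \<forall>y\<in>Y. commutator G w y \<in> N}" using a b by simp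
qed auto

lemma Hall_Witt:
  assumes "x \<in> carrier G" "y \<in> carrier G" "z \<in> carrier G"
  shows "(inv y \<otimes> commutator G (commutator G x (inv y)) z \<otimes> y)
       \<otimes> (inv z \<otimes> commutator G (commutator G y (inv z)) x \<otimes> z)
       \<otimes> (inv x \<otimes> commutator G (commutator G z (inv x)) y \<otimes> x) = \<one>"
  using assms by (simp add: word_simps)

text \<open>The Hall-Witt identity expresses a conjugate of \<open>[[z, x], y]\<close> through
  conjugates of commutators of the two other types, which lie in the normal subgroup
  \<open>N\<close>.\<close>

lemma three_subgroups:
  assumes X: "subgroup A G" and Y: "subgroup B G" and Z: "subgroup C G" and N: "N \<lhd> G"
    and 1: "comm_subgroup G (comm_subgroup G A B) C \<subseteq> N"
    and 2: "comm_subgroup G (comm_subgroup G B C) A \<subseteq> N"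
  shows "comm_subgroup G (comm_subgroup G C A) B \<subseteq> N"
proof (rule comm_subgroup_least)
  show N': "subgroup N G" using N by (simp add: normal_imp_subgroup)
  note [simp] = subgroup.mem_carrier[OF X] subgroup.mem_carrier[OF Y] subgroup.mem_carrier[OF Z]
    subgroup.mem_carrier[OF N']
  have gen: "commutator G (commutator G z x) y \<in> N" if xyz: "x \<in> A" "y \<in> B" "z \<in> C" for x y z
  proof -
    \<comment> \<open>The inverse of \<open>x\<close> enters here because Hall-Witt is applied to
      \<open>inv x\<close>, \<open>y\<close>, \<open>z\<close>; its third factor then contains
      \<open>[z, x]\<close> itself.\<close>
    define n1 where "n1 = inv y \<otimes> commutator G (commutator G (inv x) (inv y)) z \<otimes> y"
    define n2 where "n2 = inv z \<otimes> commutator G (commutator G y (inv z)) (inv x) \<otimes> z"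
    define c where "c = commutator G (commutator G z x) y"
    have x': "inv x \<in> A" "inv y \<in> B" "inv z \<in> C"
      using xyz X Y Z by (auto intro: subgroup.m_inv_closed)
    have "n1 \<in> N" unfolding n1_def
      using xyz x' by (intro normal.inv_op_closed1[OF N])
        (auto intro!: subsetD[OF 1] commutator_in_comm_subgroup)
    moreover have "n2 \<in> N" unfolding n2_def
      using xyz x' by (intro normal.inv_op_closed1[OF N])
        (auto intro!: subsetD[OF 2] commutator_in_comm_subgroup)
    ultimately have n: "inv (n1 \<otimes> n2) \<in> N" "n1 \<in> carrier G" "n2 \<in> carrier G"
      by (auto intro!: subgroup.m_closed[OF N'] subgroup.m_inv_closed[OF N'])
    have c: "c \<in> carrier G" using xyz by (simp add: c_def)
    have "n1 \<otimes> n2 \<otimes> (x \<otimes> c \<otimes> inv x) = \<one>"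
      using Hall_Witt[of "inv x" y z] xyz by (simp add: n1_def n2_def c_def)
    then have "inv (x \<otimes> c \<otimes> inv x) = n1 \<otimes> n2"
      using n c xyz by (intro inv_equality) auto
    then have "x \<otimes> c \<otimes> inv x = inv (n1 \<otimes> n2)"
      using c xyz inv_inv[of "x \<otimes> c \<otimes> inv x"] by simp
    then have "x \<otimes> c \<otimes> inv x \<in> N" using n by simp
    then have "inv x \<otimes> (x \<otimes> c \<otimes> inv x) \<otimes> x \<in> N"
      using xyz by (intro normal.inv_op_closed1[OF N]) simp
    then show ?thesis using xyz c by (simp add: m_assoc inv_l_cancel c_def)
  qed
  \<comment> \<open>So far only generators \<open>[z, x]\<close> of \<open>[C, A]\<close> are
    treated; as \<open>?D\<close> is a subgroup, it contains all of \<open>[C, A]\<close>.\<close>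
  let ?D = "{w \<in> carrier G. \<forall>y\<in>B. commutator G w y \<in> N}"
  have "comm_subgroup G C A \<subseteq> ?D"
    using subgroup_centralizer_mod[OF N subgroup.subset[OF Y]] gen
    by (intro comm_subgroup_least) auto
  then show "commutator G u v \<in> N" if "u \<in> comm_subgroup G C A" "v \<in> B" for u v
    using that by blast
qed

section \<open>Iterated commutators and the lower central series\<close>

lemma comm_iter_normal: "R \<lhd> G \<Longrightarrow> comm_iter G R (carrier G) n \<lhd> G"
  by (induction n) (auto intro: comm_subgroup_normal normal_carrier)

lemma comm_iter_mono: "U \<subseteq> U' \<Longrightarrow> comm_iter G U V n \<subseteq> comm_iter G U' V n"
  by (induction n) (auto dest: comm_subgroup_mono[OF _ subset_refl])

lemma comm_iter_decreasing: "R \<lhd> G \<Longrightarrow> comm_iter G R (carrier G) n \<subseteq> R"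
proof (induction n)
  case (Suc n)
  then show ?case
    using comm_subgroup_subset_left[OF comm_iter_normal[OF Suc.prems, of n], of "carrier G"] by auto
qed simp

text \<open>The recursion of \<open>comm_iter\<close> adds commutators on the outside; this form
  splits off the innermost one.\<close>

lemma comm_iter_Suc_left: "comm_iter G (comm_subgroup G U V) V n = comm_iter G U V (Suc n)"
  by (induction n) auto

lemma gamma_Suc: "gamma G (Suc n) = comm_iter G (carrier G) (carrier G) n"
  by (induction n) auto

lemma gamma_normal: "gamma G n \<lhd> G"
  by (cases n) (auto simp: gamma_Suc intro: comm_iter_normal normal_carrier)

lemma gamma_antimono: "m \<le> n \<Longrightarrow> gamma G n \<subseteq> gamma G m"
proof (induction n rule: dec_induct)
  case (step n)
  have "gamma G (Suc n) \<subseteq> gamma G n"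
    using comm_subgroup_subset_left[OF gamma_normal, of "carrier G" n] normal_subset[OF gamma_normal]
    by (cases n) auto
  with step show ?case by blast
qed simp

text \<open>Three subgroups lemma for \<open>carrier G\<close>, \<open>R\<close> and
  \<open>gamma G (Suc n)\<close>. The induction hypothesis is used for \<open>R\<close> and also for
  \<open>[R, G]\<close>, hence \<open>R\<close> is arbitrary in the induction.\<close>

lemma comm_subgroup_gamma_subset:
  assumes "R \<lhd> G"
  shows "comm_subgroup G R (gamma G (Suc n)) \<subseteq> comm_iter G R (carrier G) (Suc n)"
  using assms
proof (induction n arbitrary: R)
  case (Suc n)
  note R = Suc.prems
  let ?N = "comm_iter G R (carrier G) (Suc (Suc n))" and ?\<Gamma> = "gamma G (Suc n)"
  have "comm_subgroup G R ?\<Gamma> \<subseteq> comm_iter G R (carrier G) (Suc n)"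
    by (rule Suc.IH[OF R])
  then have 1: "comm_subgroup G (comm_subgroup G R ?\<Gamma>) (carrier G) \<subseteq> ?N"
    using comm_subgroup_mono by simp
  have "comm_subgroup G (comm_subgroup G R (carrier G)) ?\<Gamma> \<subseteq> ?N"
    using Suc.IH[OF comm_subgroup_normal[OF R normal_carrier]]
    by (simp only: comm_iter_Suc_left)
  then have 2: "comm_subgroup G (comm_subgroup G (carrier G) R) ?\<Gamma> \<subseteq> ?N"
    using comm_subgroup_commute[of R "carrier G"] normal_subset[OF R] by simp
  have "comm_subgroup G (comm_subgroup G ?\<Gamma> (carrier G)) R \<subseteq> ?N"
    by (rule three_subgroups[OF _ _ _ comm_iter_normal[OF R] 2 1])
      (simp_all only: normal_imp_subgroup R gamma_normal normal_carrier)
  moreover have "comm_subgroup G ?\<Gamma> (carrier G) = gamma G (Suc (Suc n))" by simp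
  ultimately have "comm_subgroup G (gamma G (Suc (Suc n))) R \<subseteq> ?N" by (simp only:)
  then show ?case
    by (simp only: comm_subgroup_commute[OF normal_subset[OF R] normal_subset[OF gamma_normal]])
qed simp

end

section \<open>Commutator subgroups under homomorphisms\<close>

lemma (in group_hom) hom_commutator:
  "u \<in> carrier G \<Longrightarrow> v \<in> carrier G \<Longrightarrow> h (commutator G u v) = commutator H (h u) (h v)"
  by (simp add: commutator_def)

lemma (in group_hom) image_comm_subgroup:
  assumes "U \<subseteq> carrier G" "V \<subseteq> carrier G"
  shows "h ` comm_subgroup G U V = comm_subgroup H (h ` U) (h ` V)"
proof -
  have "{commutator H u v | u v. u \<in> h ` U \<and> v \<in> h ` V}
      = h ` {commutator G u v | u v. u \<in> U \<and> v \<in> V}" (is "?A = h ` ?B")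
  proof
    show "?A \<subseteq> h ` ?B"
    proof
      fix c assume "c \<in> ?A"
      then obtain u v where uv: "u \<in> U" "v \<in> V" "c = commutator H (h u) (h v)" by blast
      then have "c = h (commutator G u v)" using assms by (subst hom_commutator) auto
      with uv show "c \<in> h ` ?B" by blast
    qed
    show "h ` ?B \<subseteq> ?A" using assms by (fastforce simp: hom_commutator subset_iff)
  qed
  moreover have "?B \<subseteq> carrier G" using assms by auto
  ultimately show ?thesis unfolding comm_subgroup_eq using generate_img by simp
qed

lemma (in group_hom) image_gamma:
  assumes "h ` carrier G = carrier H"
  shows "h ` gamma G n = gamma H n"
proof (induction n rule: nat_less_induct)
  case (1 n)
  consider "n = 0" | "n = Suc 0" | m where "n = Suc (Suc m)"
    using not0_implies_Suc by blast
  then show ?case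
  proof cases
    case (3 m)
    then show ?thesis
      using 1 assms image_comm_subgroup[OF G.normal_subset[OF G.gamma_normal] subset_refl] by simp
  qed (use assms in auto)
qed

section \<open>Subquotients\<close>

lemma carrier_subquot: "carrier (subquot G A N) = (\<lambda>x. N #>\<^bsub>G\<^esub> x) ` A"
  by (auto simp: subquot_def carrier_FactGroup r_coset_def)

lemma mult_subquot: "monoid.mult (subquot G A N) = set_mult G"
  by (simp add: subquot_def set_mult_def fun_eq_iff)

text \<open>An equation of records: multiplication and unit of a factor group do not depend on the
  carrier of the numerator. It lets \<open>K\<close> be literally the kernel inside the
  multiplier.\<close>

lemma subquot_eq_subgroup: "subquot G B N = (subquot G A N)\<lparr>carrier := carrier (subquot G B N)\<rparr>"
  by (simp add: subquot_def FactGroup_def set_mult_def fun_eq_iff)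

context group
begin

lemma subquot_normal:
  assumes "subgroup A G" "N \<lhd> G" "N \<subseteq> A"
  shows "N \<lhd> G\<lparr>carrier := A\<rparr>"
  by (rule normal_restrict_supergroup[OF assms])

lemma group_subquot:
  assumes "subgroup A G" "N \<lhd> G" "N \<subseteq> A"
  shows "group (subquot G A N)"
  unfolding subquot_def by (rule normal.factorgroup_is_group[OF subquot_normal[OF assms]])

text \<open>The quotient of \<open>x \<otimes> y\<close> by \<open>y \<otimes> x\<close> is the
  commutator of \<open>inv x\<close> and \<open>inv y\<close>, so it lies in
  \<open>N\<close>.\<close>

lemma comm_group_subquot:
  assumes A: "subgroup A G" and N: "N \<lhd> G" "N \<subseteq> A" and comm: "comm_subgroup G A A \<subseteq> N"
  shows "comm_group (subquot G A N)"
proof (rule group.group_comm_groupI[OF group_subquot[OF A N]])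
  fix P Q assume "P \<in> carrier (subquot G A N)" "Q \<in> carrier (subquot G A N)"
  then obtain x y where xy: "x \<in> A" "y \<in> A" "P = N #> x" "Q = N #> y"
    by (auto simp: carrier_subquot)
  then have c: "x \<in> carrier G" "y \<in> carrier G" using subgroup.mem_carrier[OF A] by auto
  have "inv x \<in> A" "inv y \<in> A" using xy subgroup.m_inv_closed[OF A] by auto
  then have "commutator G (inv x) (inv y) \<in> N" using comm commutator_in_comm_subgroup by blast
  then have "x \<otimes> y \<otimes> inv (y \<otimes> x) \<in> N" using c by (simp add: word_simps)
  moreover have "x \<otimes> y = x \<otimes> y \<otimes> inv (y \<otimes> x) \<otimes> (y \<otimes> x)"
    using c by (simp add: word_simps)
  ultimately have "x \<otimes> y \<in> N #> (y \<otimes> x)" unfolding r_coset_def by blast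
  then have "N #> (x \<otimes> y) = N #> (y \<otimes> x)"
    using c N repr_independence[of "x \<otimes> y" N "y \<otimes> x"] by (simp add: normal_imp_subgroup)
  then show "P \<otimes>\<^bsub>subquot G A N\<^esub> Q = Q \<otimes>\<^bsub>subquot G A N\<^esub> P"
    using xy c N by (simp add: mult_subquot normal.rcos_sum)
qed

lemma r_coset_hom_subquot:
  assumes "subgroup A G" "subgroup B G" "A \<subseteq> B" "N \<lhd> G" "N \<subseteq> B"
  shows "group_hom (G\<lparr>carrier := A\<rparr>) (subquot G B N) (\<lambda>x. N #> x)"
proof -
  have "N #> (x \<otimes> y) = (N #> x) <#> (N #> y)" if "x \<in> A" "y \<in> A" for x y
    using that assms by (simp add: normal.rcos_sum subgroup.mem_carrier)
  then show ?thesis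
    using assms group_subquot[of B N] subgroup_imp_group[of A]
    by (auto simp: group_hom_def group_hom_axioms_def hom_def carrier_subquot mult_subquot)
qed

end

text \<open>Universal property of the quotient. The kernel is given as a subquotient with
  denominator \<open>N\<close>, ready to be compared with an image inside the same group.\<close>

lemma (in group_hom) subquot_lift:
  assumes A: "subgroup A G" "N \<lhd> G" "N \<subseteq> A" and ker: "N \<subseteq> kernel G H h"
  obtains g where "group_hom (subquot G A N) H g" "\<And>x. x \<in> A \<Longrightarrow> g (N #> x) = h x"
    "kernel (subquot G A N) H g = carrier (subquot G (A \<inter> kernel G H h) N)"
proof -
  interpret A: group_hom "G\<lparr>carrier := A\<rparr>" H h by (rule induced_group_hom'[OF A(1)])
  have "N \<subseteq> kernel (G\<lparr>carrier := A\<rparr>) H h" using A ker by (auto simp: kernel_def)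
  from A.FactGroup_universal_kernel[OF G.subquot_normal[OF A] this]
  obtain g where g: "g \<in> hom (subquot G A N) H" "\<And>x. x \<in> A \<Longrightarrow> g (N #> x) = h x"
    by (auto simp: subquot_def r_coset_def)
  have "group_hom (subquot G A N) H g"
    using g G.group_subquot[OF A] H.group_axioms by (auto simp: group_hom_def group_hom_axioms_def)
  moreover have "kernel (subquot G A N) H g = carrier (subquot G (A \<inter> kernel G H h) N)"
    using g(2) subgroup.mem_carrier[OF A(1)] by (auto simp: kernel_def carrier_subquot)
  ultimately show thesis using that g(2) by blast
qed

section \<open>The exact sequence of multipliers\<close>

text \<open>The map \<open>f\<close> is induced by the inclusion of
  \<open>R \<inter> \<Gamma>\<close> in \<open>T \<inter> \<Gamma>\<close>, and \<open>g\<close> by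
  \<open>h\<close>, where \<open>\<Gamma>\<close> is \<open>gamma G (Suc c)\<close>. The conclusions
  are the exact sequence together with commutativity of both multipliers.\<close>

lemma (in group_hom) multiplier_quotient_hom:
  assumes surj: "h ` carrier G = carrier H" and nilp: "gamma H (Suc t) = {\<one>\<^bsub>H\<^esub>}" "t \<noteq> 0"
    and c: "c \<noteq> 0"
  defines "R \<equiv> kernel G H h"
  defines "T \<equiv> R <#> gamma G t"
  defines "M \<equiv> c_multiplier c G R" and "M' \<equiv> c_multiplier c G T"
    and "K \<equiv> subquot G (comm_iter G T (carrier G) c) (comm_iter G R (carrier G) c)"
  obtains f g where
    "group_hom M M' f" "comm_group M" "comm_group M'" "K = M\<lparr>carrier := kernel M M' f\<rparr>"
    "group_hom M' H g" "kernel M' H g = f ` carrier M" "g ` carrier M' = gamma H t \<inter> gamma H (Suc c)"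
proof -
  define \<Gamma> where "\<Gamma> = gamma G (Suc c)"
  define N0 where "N0 = comm_iter G R (carrier G) c"
  define N1 where "N1 = comm_iter G T (carrier G) c"
  have R: "R \<lhd> G" unfolding R_def by (rule normal_kernel)
  have T_eq: "T = {x \<in> carrier G. h x \<in> gamma H t}"
  proof
    show "T \<subseteq> {x \<in> carrier G. h x \<in> gamma H t}"
    proof
      fix x assume "x \<in> T"
      then obtain r u where x: "r \<in> R" "u \<in> gamma G t" "x = r \<otimes> u"
        by (auto simp: T_def set_mult_def)
      have u: "u \<in> carrier G" "h u \<in> gamma H t"
        using x(2) G.normal_subset[OF G.gamma_normal] image_gamma[OF surj] by blast+
      then show "x \<in> {x \<in> carrier G. h x \<in> gamma H t}"
        using x H.normal_subset[OF H.gamma_normal] by (auto simp: R_def kernel_def)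
    qed
    show "{x \<in> carrier G. h x \<in> gamma H t} \<subseteq> T"
    proof safe
      fix x assume x: "x \<in> carrier G" "h x \<in> gamma H t"
      then obtain u where u: "u \<in> gamma G t" "h x = h u" using image_gamma[OF surj, of t] by auto
      then have u': "u \<in> carrier G" using G.normal_subset[OF G.gamma_normal] by blast
      then have "x \<otimes> inv u \<in> R" using x u by (simp add: R_def kernel_def)
      moreover have "x = (x \<otimes> inv u) \<otimes> u" using x u' by (simp add: G.m_assoc)
      ultimately show "x \<in> T" using u unfolding T_def set_mult_def by blast
    qed
  qed
  have T: "T \<lhd> G"
    unfolding T_def using G.normal_subgroup_set_mult_closed[OF R G.gamma_normal] .
  have RT: "R \<subseteq> T"
    using subgroup.one_closed[OF normal_imp_subgroup[OF H.gamma_normal]]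
    by (auto simp: T_eq R_def kernel_def)
  note normal = G.comm_iter_normal[OF R, of c, folded N0_def] G.comm_iter_normal[OF T, of c, folded N1_def]
  note sub = normal_imp_subgroup[OF R] normal_imp_subgroup[OF T]
    normal_imp_subgroup[OF G.gamma_normal, of "Suc c", folded \<Gamma>_def]
  have \<Gamma>: "comm_iter G U (carrier G) c \<subseteq> \<Gamma>" if "U \<subseteq> carrier G" for U
    unfolding \<Gamma>_def G.gamma_Suc by (rule G.comm_iter_mono[OF that])
  have N01: "N0 \<subseteq> N1" unfolding N0_def N1_def by (rule G.comm_iter_mono[OF RT])
  have "comm_subgroup G T (carrier G) \<subseteq> R"
  proof (rule G.comm_subgroup_least[OF sub(1)])
    fix u v assume uv: "u \<in> T" "v \<in> carrier G"
    \<comment> \<open>The recursion \<open>gamma H (Suc t) = [gamma H t, H]\<close> starts at index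
      1, because \<open>gamma H 0\<close> is set by convention.\<close>
    obtain s where s: "t = Suc s" using nilp(2) not0_implies_Suc by blast
    have "commutator H (h u) (h v) \<in> comm_subgroup H (gamma H t) (carrier H)"
      using uv by (intro H.commutator_in_comm_subgroup) (auto simp: T_eq)
    also have "\<dots> = {\<one>\<^bsub>H\<^esub>}" using nilp(1) s by simp
    finally show "commutator G u v \<in> R"
      using uv by (simp add: R_def kernel_def T_eq hom_commutator)
  qed
  \<comment> \<open>The first of the \<open>c \<ge> 1\<close> commutators moves \<open>T\<close>
    into \<open>R\<close>; the remaining ones stay there by normality.\<close>
  then have "comm_iter G (comm_subgroup G T (carrier G)) (carrier G) d \<subseteq> R" for d
    by (rule subset_trans[OF G.comm_iter_mono G.comm_iter_decreasing[OF R]])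
  moreover obtain d where "c = Suc d" using c not0_implies_Suc by blast
  ultimately have "N1 \<subseteq> R" by (simp only: N1_def G.comm_iter_Suc_left)
  then have N1R: "N1 \<subseteq> R \<inter> \<Gamma>"
    using \<Gamma>[OF G.normal_subset[OF T]] by (simp add: N1_def)
  have A: "subgroup (R \<inter> \<Gamma>) G" "subgroup (T \<inter> \<Gamma>) G"
    using sub by (auto intro: G.subgroups_Inter_pair)
  have M: "M = subquot G (R \<inter> \<Gamma>) N0" "M' = subquot G (T \<inter> \<Gamma>) N1" "K = subquot G N1 N0"
    by (simp_all add: M_def M'_def K_def c_multiplier_def N0_def N1_def \<Gamma>_def)
  have abelian: "comm_subgroup G (U \<inter> \<Gamma>) (U \<inter> \<Gamma>) \<subseteq> comm_iter G U (carrier G) c" if U: "U \<lhd> G" for U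
  proof -
    have "comm_subgroup G (U \<inter> \<Gamma>) (U \<inter> \<Gamma>) \<subseteq> comm_subgroup G U \<Gamma>"
      by (intro G.comm_subgroup_mono) auto
    also have "\<dots> \<subseteq> comm_iter G U (carrier G) (Suc c)"
      unfolding \<Gamma>_def by (rule G.comm_subgroup_gamma_subset[OF U])
    also have "\<dots> \<subseteq> comm_iter G U (carrier G) c"
      using G.comm_subgroup_subset_left[OF G.comm_iter_normal[OF U]] by simp
    finally show ?thesis .
  qed
  have commM: "comm_group M" unfolding M
    using N01 N1R abelian[OF R, folded N0_def] by (intro G.comm_group_subquot A normal) auto
  have commM': "comm_group M'" unfolding M
    using RT N1R abelian[OF T, folded N1_def] by (intro G.comm_group_subquot A normal) auto

  \<comment> \<open>This map has kernel \<open>N1\<close>, which contains \<open>N0\<close>; it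
    therefore factors through \<open>M\<close> as \<open>f\<close>, with kernel
    \<open>N1/N0 = K\<close>.\<close>
  interpret q: group_hom "G\<lparr>carrier := R \<inter> \<Gamma>\<rparr>" M' "\<lambda>x. N1 #> x"
    unfolding M using RT N1R by (intro G.r_coset_hom_subquot A normal) auto
  have N1: "x \<in> N1 \<longleftrightarrow> N1 #> x = N1" if "x \<in> carrier G" for x
    using G.coset_join1[of N1 x] G.coset_join2[of x N1] that normal normal_imp_subgroup by blast
  have ker_q: "kernel (G\<lparr>carrier := R \<inter> \<Gamma>\<rparr>) M' (\<lambda>x. N1 #> x) = N1"
    using N1 N1R subgroup.mem_carrier[OF A(1)] by (auto simp: kernel_def M subquot_def)
  have "N0 \<lhd> G\<lparr>carrier := R \<inter> \<Gamma>\<rparr>"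
    using N01 N1R by (intro G.subquot_normal A normal) auto
  then obtain f where f: "f \<in> hom M M'" "\<And>x. x \<in> R \<inter> \<Gamma> \<Longrightarrow> f (N0 #> x) = N1 #> x"
    using q.FactGroup_universal_kernel[of N0] ker_q N01
    by (auto simp: M(1) subquot_def r_coset_def)
  have 1: "group_hom M M' f"
    using f(1) commM commM' by (simp add: group_hom_def group_hom_axioms_def comm_group.axioms(2))
  have "f (N0 #> x) = N1 \<longleftrightarrow> x \<in> N1" if "x \<in> R \<inter> \<Gamma>" for x
    using f(2)[OF that] N1[of x] subgroup.mem_carrier[OF A(1) that] by simp
  moreover have "\<one>\<^bsub>M'\<^esub> = N1" by (simp add: M(2) subquot_def)
  ultimately have "kernel M M' f = carrier K"
    using N1R unfolding kernel_def M(1,3) carrier_subquot by auto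
  then have 2: "K = M\<lparr>carrier := kernel M M' f\<rparr>"
    using subquot_eq_subgroup[of G N1 N0 "R \<inter> \<Gamma>"] by (simp add: M)

  \<comment> \<open>Since \<open>N1\<close> lies in \<open>R\<close>, the kernel of
    \<open>h\<close>, the restriction of \<open>h\<close> to \<open>T \<inter> \<Gamma>\<close>
    descends to \<open>M'\<close>.\<close>
  have "N1 \<subseteq> T \<inter> \<Gamma>" "N1 \<subseteq> kernel G H h" using N1R RT by (auto simp: R_def)
  from subquot_lift[OF A(2) normal(2) this] obtain g where
    g: "group_hom M' H g" "\<And>x. x \<in> T \<inter> \<Gamma> \<Longrightarrow> g (N1 #> x) = h x"
    "kernel M' H g = carrier (subquot G (T \<inter> \<Gamma> \<inter> R) N1)"
    unfolding M R_def by blast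
  have "T \<inter> \<Gamma> \<inter> R = R \<inter> \<Gamma>" using RT by blast
  then have 3: "kernel M' H g = f ` carrier M"
    using f(2) g(3) by (simp add: M carrier_subquot image_image)
  have "g ` carrier M' = h ` (T \<inter> \<Gamma>)"
    using g(2) by (simp add: M carrier_subquot image_image)
  \<comment> \<open>\<open>T\<close> is a full preimage, so intersecting with it commutes with
    taking images under \<open>h\<close>.\<close>
  also have "\<dots> = gamma H t \<inter> gamma H (Suc c)"
    unfolding T_eq image_gamma[OF surj, of "Suc c", folded \<Gamma>_def, symmetric]
    using subgroup.subset[OF sub(3)] by blast
  finally show thesis using that 1 commM commM' 2 g(1) 3 by blast
qed

text \<open>\<open>RT\<close> is the kernel of the composite of \<open>F\<close> onto
  \<open>G\<close> and \<open>G\<close> onto its quotient by \<open>gamma G t\<close>, so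
  \<open>c_multiplier c F RT\<close> is the multiplier of that quotient.\<close>

theorem theorem29:
  fixes G :: "('g, 'm) monoid_scheme" and F :: "('f, 'n) monoid_scheme"
    and S :: "'f set" and R :: "'f set" and c t :: nat
  assumes "c \<ge> 1"
    and "group G" and "finite (carrier G)"
    and "t \<ge> 2" and "nilpotent_class G t"
    and "free_group_on F S" and "R \<lhd> F" and "F Mod R \<cong> G"
  defines "RT \<equiv> R <#>\<^bsub>F\<^esub> gamma F t"
  defines "K \<equiv> subquot F (comm_iter F RT (carrier F) c) (comm_iter F R (carrier F) c)"
  shows "(c + 1 \<le> t \<longrightarrow>
            card (gamma G t) * order (c_multiplier c F R)
              = order (c_multiplier c F RT) * order K)
       \<and> (c + 1 > t \<longrightarrow>
            card (gamma G (c + 1)) * order (c_multiplier c F R)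
              = order (c_multiplier c F RT) * order K)
       \<and> group_exponent (c_multiplier c F R)
            dvd group_exponent (c_multiplier c F RT) * group_exponent K
       \<and> min_gens (c_multiplier c F R)
            \<le> min_gens (c_multiplier c F RT) + min_gens K"
proof -
  interpret F: group F using \<open>free_group_on F S\<close> by (simp add: free_group_on_def)
  interpret G: group G by fact
  interpret R: normal R F by fact
  from \<open>F Mod R \<cong> G\<close> obtain i where i: "i \<in> iso (F Mod R) G" by (auto simp: is_iso_def)
  define h where "h x = i (R #>\<^bsub>F\<^esub> x)" for x
  have "h \<in> hom F G"
    using hom_compose[OF R.r_coset_hom_Mod, of i G] i by (simp add: iso_def h_def[abs_def] comp_def)
  then interpret h: group_hom F G h by unfold_locales
  have surj: "h ` carrier F = carrier G"
    using i by (auto simp: iso_def bij_betw_def h_def carrier_FactGroup image_image)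
  have ker: "kernel F G h = R"
  proof -
    interpret i: group_hom "F Mod R" G i
      using i R.factorgroup_is_group G.group_axioms
      by (simp add: group_hom_def group_hom_axioms_def iso_def)
    have "h x = \<one>\<^bsub>G\<^esub> \<longleftrightarrow> x \<in> R" if x: "x \<in> carrier F" for x
    proof -
      have "R #>\<^bsub>F\<^esub> x \<in> carrier (F Mod R)"
        using x by (auto simp: carrier_FactGroup)
      moreover have "R \<in> carrier (F Mod R)" using i.G.one_closed by simp
      ultimately have "h x = \<one>\<^bsub>G\<^esub> \<longleftrightarrow> R #>\<^bsub>F\<^esub> x = R"
        using i i.hom_one by (auto simp: iso_def bij_betw_def h_def inj_on_def)
      also have "\<dots> \<longleftrightarrow> x \<in> R"
        using x F.coset_join1 F.coset_join2 R.subgroup_axioms R.subset by blast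
      finally show ?thesis .
    qed
    then show ?thesis using R.subset by (auto simp: kernel_def)
  qed
  have nilp: "gamma G (Suc t) = {\<one>\<^bsub>G\<^esub>}" "t \<noteq> 0" "c \<noteq> 0"
    using assms(1,4,5) by (auto simp: nilpotent_class_def)
  let ?M = "c_multiplier c F R" and ?M' = "c_multiplier c F RT"
  obtain f g where "group_hom ?M ?M' f" "comm_group ?M" "comm_group ?M'"
    and K: "K = ?M\<lparr>carrier := kernel ?M ?M' f\<rparr>"
    and "group_hom ?M' G g" and g: "kernel ?M' G g = f ` carrier ?M"
      "g ` carrier ?M' = gamma G t \<inter> gamma G (Suc c)"
    using h.multiplier_quotient_hom[OF surj nilp] unfolding ker RT_def[symmetric] K_def[symmetric]
    by blast
  interpret f: group_hom ?M ?M' f by fact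
  interpret g: group_hom ?M' G g by fact
  \<comment> \<open>By exactness the image of \<open>f\<close> is the kernel of \<open>g\<close>;
    its cardinality occurs in both order formulas and links them without any division.\<close>
  have "card (g ` carrier ?M') * order ?M = order ?M' * order K"
    using f.order_eq_kernel_image g.order_eq_kernel_image unfolding g(1) by (simp add: K order_def)
  \<comment> \<open>The lower central series is decreasing, so the intersection is the term of
    larger index; the two cases of (i) are the two values of the maximum.\<close>
  moreover have "g ` carrier ?M' = gamma G (max t (Suc c))"
    using G.gamma_antimono[of t "Suc c"] G.gamma_antimono[of "Suc c" t] unfolding g(2)
    by (auto simp: max_def)
  ultimately have ord: "card (gamma G (max t (Suc c))) * order ?M = order ?M' * order K" by simp
  \<comment> \<open>The image of \<open>f\<close> is the kernel of \<open>g\<close>, so its cosets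
    embed in the finite group \<open>G\<close>, even if \<open>?M'\<close> is infinite.\<close>
  have fin: "finite (rcosets\<^bsub>?M'\<^esub> (f ` carrier ?M))"
  proof -
    have "finite (g ` carrier ?M')"
      using \<open>finite (carrier G)\<close> g.hom_closed by (intro finite_subset[of "g ` carrier ?M'" "carrier G"]) auto
    moreover have "inj_on (\<lambda>Q. the_elem (g ` Q)) (rcosets\<^bsub>?M'\<^esub> (f ` carrier ?M))"
      using g.FactGroup_inj_on unfolding g(1) by (simp add: FactGroup_def)
    moreover have "(\<lambda>Q. the_elem (g ` Q)) ` (rcosets\<^bsub>?M'\<^esub> (f ` carrier ?M)) \<subseteq> carrier G"
      using g.FactGroup_the_elem_mem unfolding g(1) by (auto simp: FactGroup_def)
    ultimately show ?thesis
      using \<open>finite (carrier G)\<close> by (meson finite_imageD finite_subset)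
  qed
  have "min_gens ?M \<le> min_gens ?M' + min_gens K"
    unfolding K by (intro f.min_gens_le_add \<open>comm_group ?M\<close> \<open>comm_group ?M'\<close> fin)
  moreover have "group_exponent ?M dvd group_exponent ?M' * group_exponent K"
    unfolding K by (rule f.group_exponent_dvd_mult)
  ultimately show ?thesis using ord by (auto simp: max_def)
qed

end
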